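(* Let $\Gamma:\ell_\infty^+\to\ell_\infty^+$ be a well-defined and continuous max-type gain operator satisfying the following assumptions: (i) The system $s(k+1)=\Gamma(s(k))$ induced by $\Gamma$ is UGAS. (ii) For each compact interval $J\subset(0,\infty)$ there are $0<l<L$ such that $$l|r_1-r_2|\le|\gamma_{ij}(r_1)-\gamma_{ij}(r_2)|\le L|r_1-r_2|$$ for all $r_1,r_2\in J$ and $i\in\mathbb{N}$, $j\in I_i$. Then $\sigma(r):=\sigma_*(r)=\sigma^*(r)$ (the equality $\sigma_*=\sigma^*$ holding for every $\varphi$ admissible in the definition of $\sigma^*$) is a path of decay for $\Gamma$.
   Context: $\mathbb{N}=\{1,2,\dots\}$, $\mathbb{Z}_+=\{0,1,\dots\}$, $\mathbb{R}_+=[0,\infty)$. $\ell_\infty$ is the Banach space of bounded real sequences with sup norm $\|\cdot\|_\infty$; $\ell_\infty^+$ is the cone of nonnegative sequences; $\le$ is the componentwise order; $\oplus$, $\bigoplus$ denote componentwise max/supremum; $\mathbb{1}$ is the sequence with all components $1$. $\mathcal{K}$: continuous strictly increasing $\gamma:\mathbb{R}_+\to\mathbb{R}_+$ with $\gamma(0)=0$; $\mathcal{K}_\infty$: unbounded elements of $\mathcal{K}$; $\mathcal{KL}$: continuous $\beta:\mathbb{R}_+^2\to\mathbb{R}_+$ with $\beta(\cdot,t)\in\mathcal{K}$ for all $t\ge0$ and, for all $r>0$, $\beta(r,\cdot)$ strictly decreasing with limit $0$ at infinity. Max-type gain operator: for each $i\in\mathbb{N}$ one is given a finite set $I_i\subset\mathbb{N}\setminus\{i\}$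 and functions $\gamma_{ij}\in\mathcal{K}\cup\{0\}$ ($j\in\mathbb{N}$) with $\gamma_{ij}=0$ for $j\notin I_i$; $\Gamma(s)=(\sup_{j\in\mathbb{N}}\gamma_{ij}(s_j))_{i\in\mathbb{N}}$. "Well-defined and continuous": $\Gamma$ maps $\ell_\infty^+$ into itself and is norm-continuous. The system $s(k+1)=\Gamma(s(k))$ is UGAS if there is $\beta\in\mathcal{KL}$ with $\|\Gamma^k(s)\|_\infty\le\beta(\|s\|_\infty,k)$ for all $s\in\ell_\infty^+$, $k\ge0$. Augmented gain operator: $\hat\Gamma(s)=s\oplus\Gamma(s)$. $\sigma_*(r):=\bigoplus_{k=0}^\infty\hat\Gamma^k(r\mathbb{1})$ for $r\ge0$. For $r\ge0$, $\Gamma_r(s):=r\mathbb{1}\oplus\Gamma(s)$. $\sigma^*$ is defined by $\sigma^*_i(r):=\inf_{n\in\mathbb{Z}_+}\pi_i(\Gamma_r^n(\varphi(r)\mathbb{1}))$, $\pi_i$ being the $i$th coordinate, where $\varphi\in\mathcal{K}_\infty$ is a function witnessing the $\oplus$-MBI property of $\Gamma$, i.e. for all $s,b\in\ell_\infty^+$: $s\le\Gamma(s)\oplus b\Rightarrow\|s\|_\infty\le\varphi(\|b\|_\infty)$; such a $\varphi$ is called admissible. A path of decay for $\Gamma$ is a mapping $\sigma:\mathbb{R}_+\to\ell_\infty^+$, with components $\sigma_i$, such that: (P1) $\Gamma(\sigma(r))\le\sigma(r)$ for all $r\ge0$; (P2) there are $\sigma_{\min},\sigma_{\max}\in\mathcal{K}_\infty$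 with $\sigma_{\min}\le\sigma_i\le\sigma_{\max}$ for all $i$; (P3) each $\sigma_i\in\mathcal{K}_\infty$; (P4) for every compact interval $J\subset(0,\infty)$ there are $0<c\le C<\infty$ with $c|r_1-r_2|\le|\sigma_i^{-1}(r_1)-\sigma_i^{-1}(r_2)|\le C|r_1-r_2|$ for all $r_1,r_2\in J$, $i\in\mathbb{N}$. *)

theory Defs
  imports "HOL-Analysis.Analysis"
begin

text \<open>Comparison functions live on \<open>[0,\<infinity>)\<close>: a total function on the reals is used, and its values at
  negative arguments are never constrained. Nonnegativity of the values follows from
  \<open>\<gamma> 0 = 0\<close> and monotonicity.\<close>

definition class_K :: "(real \<Rightarrow> real) \<Rightarrow> bool" where
  "class_K \<gamma> \<longleftrightarrow> continuous_on {0..} \<gamma> \<and> strict_mono_on {0..} \<gamma> \<and> \<gamma> 0 = 0"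

definition class_Kinf :: "(real \<Rightarrow> real) \<Rightarrow> bool" where
  "class_Kinf \<gamma> \<longleftrightarrow> class_K \<gamma> \<and> \<not> bdd_above (\<gamma> ` {0..})"

definition class_KL :: "(real \<Rightarrow> real \<Rightarrow> real) \<Rightarrow> bool" where
  "class_KL \<beta> \<longleftrightarrow>
     continuous_on ({0..} \<times> {0..}) (\<lambda>(r, t). \<beta> r t) \<and>
     (\<forall>t\<ge>0. class_K (\<lambda>r. \<beta> r t)) \<and>
     (\<forall>r>0. strict_antimono_on {0..} (\<beta> r) \<and> (\<beta> r \<longlongrightarrow> 0) at_top)"

text \<open>The topology of \<^typ>\<open>nat\<close> is discrete, so bounded continuous functions on \<^typ>\<open>nat\<close> are
  exactly the bounded sequences, with the sup norm. The index set \<open>{1, 2, \<dots>}\<close> is replaced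
  by \<open>{0, 1, \<dots>}\<close>. The sequence with all components equal to \<open>r\<close> is \<^term>\<open>const_bcontfun r\<close>.\<close>

type_synonym linf = "nat \<Rightarrow>\<^sub>C real"

lemma bcontfun_nat_iff: "(s :: nat \<Rightarrow> real) \<in> bcontfun \<longleftrightarrow> bounded (range s)"
  by (simp add: bcontfun_def)

definition linf_pos :: "linf set" where
  "linf_pos = {s. \<forall>i. 0 \<le> apply_bcontfun s i}"

definition linf_le :: "linf \<Rightarrow> linf \<Rightarrow> bool" (infix \<open>\<sqsubseteq>\<close> 50) where
  "s \<sqsubseteq> t \<longleftrightarrow> (\<forall>i. apply_bcontfun s i \<le> apply_bcontfun t i)"

definition linf_max :: "linf \<Rightarrow> linf \<Rightarrow> linf" (infixl \<open>\<oplus>\<close> 65) where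
  "s \<oplus> t = Bcontfun (\<lambda>i. max (apply_bcontfun s i) (apply_bcontfun t i))"

lemma apply_linf_max [simp]:
  "apply_bcontfun (s \<oplus> t) i = max (apply_bcontfun s i) (apply_bcontfun t i)"
proof -
  have "bounded (range (apply_bcontfun s) \<union> range (apply_bcontfun t))"
    by simp
  then have "bounded (range (\<lambda>i. max (apply_bcontfun s i) (apply_bcontfun t i)))"
    by (rule bounded_subset) (auto simp: max_def)
  then show ?thesis
    by (simp add: linf_max_def Bcontfun_inverse bcontfun_nat_iff)
qed

definition max_type_gains :: "(nat \<Rightarrow> nat set) \<Rightarrow> (nat \<Rightarrow> nat \<Rightarrow> real \<Rightarrow> real) \<Rightarrow> bool" where
  "max_type_gains I \<gamma> \<longleftrightarrow>
     (\<forall>i. finite (I i) \<and> i \<notin> I i) \<and>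
     (\<forall>i j. class_K (\<gamma> i j) \<or> (\<forall>r\<ge>0. \<gamma> i j r = 0)) \<and>
     (\<forall>i j. j \<notin> I i \<longrightarrow> (\<forall>r\<ge>0. \<gamma> i j r = 0))"

definition gain_seq :: "(nat \<Rightarrow> nat \<Rightarrow> real \<Rightarrow> real) \<Rightarrow> linf \<Rightarrow> nat \<Rightarrow> real" where
  "gain_seq \<gamma> s i = (SUP j. \<gamma> i j (apply_bcontfun s j))"

text \<open>The gain operator as a map into \<open>\<ell>\<^sub>\<infinity>\<close>; it is meaningful only under the
  well-definedness condition below. There the suprema need no side condition: for
  \<^const>\<open>max_type_gains\<close> and nonnegative \<open>s\<close> they range over finite sets.\<close>

definition gain_op :: "(nat \<Rightarrow> nat \<Rightarrow> real \<Rightarrow> real) \<Rightarrow> linf \<Rightarrow> linf" where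
  "gain_op \<gamma> s = Bcontfun (gain_seq \<gamma> s)"

definition gain_well_defined :: "(nat \<Rightarrow> nat \<Rightarrow> real \<Rightarrow> real) \<Rightarrow> bool" where
  "gain_well_defined \<gamma> \<longleftrightarrow>
     (\<forall>s\<in>linf_pos. bounded (range (gain_seq \<gamma> s)) \<and> (\<forall>i. 0 \<le> gain_seq \<gamma> s i))"

definition UGAS :: "(linf \<Rightarrow> linf) \<Rightarrow> bool" where
  "UGAS \<Gamma> \<longleftrightarrow>
     (\<exists>\<beta>. class_KL \<beta> \<and> (\<forall>s\<in>linf_pos. \<forall>k. norm ((\<Gamma> ^^ k) s) \<le> \<beta> (norm s) (real k)))"

definition augmented :: "(linf \<Rightarrow> linf) \<Rightarrow> linf \<Rightarrow> linf" where
  "augmented \<Gamma> s = s \<oplus> \<Gamma> s"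

text \<open>This is the intended supremum in \<open>\<ell>\<^sub>\<infinity>\<close> only if the orbit of \<open>r\<one>\<close> under the augmented operator
  is norm bounded.\<close>

definition sigma_lower :: "(linf \<Rightarrow> linf) \<Rightarrow> real \<Rightarrow> linf" where
  "sigma_lower \<Gamma> r =
     Bcontfun (\<lambda>i. SUP k. apply_bcontfun ((augmented \<Gamma> ^^ k) (const_bcontfun r)) i)"

definition admissible :: "(linf \<Rightarrow> linf) \<Rightarrow> (real \<Rightarrow> real) \<Rightarrow> bool" where
  "admissible \<Gamma> \<phi> \<longleftrightarrow> class_Kinf \<phi> \<and>
     (\<forall>s\<in>linf_pos. \<forall>b\<in>linf_pos. s \<sqsubseteq> \<Gamma> s \<oplus> b \<longrightarrow> norm s \<le> \<phi> (norm b))"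

definition gain_from :: "(linf \<Rightarrow> linf) \<Rightarrow> real \<Rightarrow> linf \<Rightarrow> linf" where
  "gain_from \<Gamma> r s = const_bcontfun r \<oplus> \<Gamma> s"

definition sigma_upper :: "(linf \<Rightarrow> linf) \<Rightarrow> (real \<Rightarrow> real) \<Rightarrow> real \<Rightarrow> nat \<Rightarrow> real" where
  "sigma_upper \<Gamma> \<phi> r i =
     (INF n. apply_bcontfun ((gain_from \<Gamma> r ^^ n) (const_bcontfun (\<phi> r))) i)"

text \<open>Compact intervals \<open>J \<subset> (0,\<infinity>)\<close> are written \<open>{a..b}\<close> with \<open>0 < a \<le> b\<close>; the inverse of a component
  is taken on \<open>[0,\<infinity>)\<close>.\<close>

definition path_of_decay :: "(linf \<Rightarrow> linf) \<Rightarrow> (real \<Rightarrow> linf) \<Rightarrow> bool" where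
  "path_of_decay \<Gamma> \<sigma> \<longleftrightarrow>
     (\<forall>r\<ge>0. \<sigma> r \<in> linf_pos) \<and>
     (\<forall>r\<ge>0. \<Gamma> (\<sigma> r) \<sqsubseteq> \<sigma> r) \<and>
     (\<exists>\<sigma>min \<sigma>max. class_Kinf \<sigma>min \<and> class_Kinf \<sigma>max \<and>
        (\<forall>i. \<forall>r\<ge>0. \<sigma>min r \<le> apply_bcontfun (\<sigma> r) i \<and> apply_bcontfun (\<sigma> r) i \<le> \<sigma>max r)) \<and>
     (\<forall>i. class_Kinf (\<lambda>r. apply_bcontfun (\<sigma> r) i)) \<and>
     (\<forall>a b. 0 < a \<and> a \<le> b \<longrightarrow>
        (\<exists>c C. 0 < c \<and> c \<le> C \<and>
           (\<forall>i. \<forall>r1\<in>{a..b}. \<forall>r2\<in>{a..b}.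
              let inv_i = inv_into {0..} (\<lambda>r. apply_bcontfun (\<sigma> r) i) in
              c * \<bar>r1 - r2\<bar> \<le> \<bar>inv_i r1 - inv_i r2\<bar> \<and>
              \<bar>inv_i r1 - inv_i r2\<bar> \<le> C * \<bar>r1 - r2\<bar>)))"

end

theory Submission
  imports Defs
begin

text \<open>
  Since \<open>\<Gamma>\<close> preserves maxima, \<open>\<sigma>\<^sub>* r\<close> is the supremum of the orbit \<open>\<Gamma>\<^sup>k (r\<one>)\<close>. UGAS makes this orbit
  decay uniformly, so for \<open>r > 0\<close> only finitely many iterates matter, uniformly in the component and
  for \<open>r\<close> in compact intervals; hence \<open>\<sigma>\<^sub>* r\<close> is a fixed point of \<open>\<Gamma>\<^sub>r\<close>. The decay of
  \<open>\<Gamma>\<^sup>n s\<close> makes \<open>\<beta>(\<cdot>, 0)\<close> admissible, and for any admissible \<open>\<phi>\<close> the iterate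
  \<open>\<Gamma>\<^sub>r\<^sup>n (\<phi>(r)\<one>)\<close> lies between \<open>\<sigma>\<^sub>* r\<close> and \<open>\<Gamma>\<^sup>n (\<phi>(r)\<one>) \<oplus> \<sigma>\<^sub>* r\<close>, which gives
  \<open>\<sigma>\<^sub>* = \<sigma>\<^sup>*\<close>. Composing the gains along the optimal paths, whose length is bounded uniformly,
  transfers their bi-Lipschitz bounds to the components of \<open>\<sigma>\<^sub>*\<close>.
\<close>

section \<open>Order and norm on bounded sequences; comparison functions\<close>

lemma linf_leD: "s \<sqsubseteq> t \<Longrightarrow> apply_bcontfun s i \<le> apply_bcontfun t i"
  by (simp add: linf_le_def)

lemma linf_pos_max [intro]: "s \<in> linf_pos \<Longrightarrow> t \<in> linf_pos \<Longrightarrow> s \<oplus> t \<in> linf_pos"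
  by (auto simp: linf_pos_def le_max_iff_disj)

lemma apply_const_bcontfun [simp]: "apply_bcontfun (const_bcontfun r :: linf) i = r"
  by (simp add: const_bcontfun.rep_eq)

lemma linf_pos_const [simp]: "const_bcontfun r \<in> linf_pos \<longleftrightarrow> 0 \<le> r"
  by (simp add: linf_pos_def)

lemma apply_le_norm: "apply_bcontfun (s :: linf) i \<le> norm s"
  using norm_bounded[of s i] by simp

lemma norm_const_linf: "0 \<le> r \<Longrightarrow> norm (const_bcontfun r :: linf) = r"
  by (intro antisym norm_bound) (use apply_le_norm[of "const_bcontfun r" 0] in auto)

text \<open>The functions whose unboundedness has to be shown below all dominate the
  identity.\<close>

lemma class_KinfI:
  assumes "class_K f" and ge: "\<And>r. 0 \<le> r \<Longrightarrow> r \<le> f r"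
  shows "class_Kinf f"
  unfolding class_Kinf_def
proof (intro conjI notI)
  assume "bdd_above (f ` {0..})"
  then obtain M where M: "\<And>r. 0 \<le> r \<Longrightarrow> f r \<le> M"
    by (auto simp: bdd_above_def)
  show False
    using M[of "\<bar>M\<bar> + 1"] ge[of "\<bar>M\<bar> + 1"] by simp
qed fact

lemma class_K_mono: "class_K f \<Longrightarrow> 0 \<le> x \<Longrightarrow> x \<le> y \<Longrightarrow> f x \<le> f y"
  using strict_mono_on_leD[of "{0..}" f x y] by (simp add: class_K_def)

section \<open>The max-type gain operator: attainment, monotonicity, maxima\<close>

locale max_gain =
  fixes I :: "nat \<Rightarrow> nat set" and \<gamma> :: "nat \<Rightarrow> nat \<Rightarrow> real \<Rightarrow> real"
  assumes gains: "max_type_gains I \<gamma>"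
    and well_defined: "gain_well_defined \<gamma>"
begin

abbreviation \<Gamma> :: "linf \<Rightarrow> linf" where "\<Gamma> \<equiv> gain_op \<gamma>"

lemma gain_cases: "class_K (\<gamma> i j) \<or> (\<forall>r\<ge>0. \<gamma> i j r = 0)"
  using gains unfolding max_type_gains_def by blast

lemma gain_outside: "j \<notin> I i \<Longrightarrow> 0 \<le> r \<Longrightarrow> \<gamma> i j r = 0"
  using gains unfolding max_type_gains_def by blast

lemma gain_mono: "0 \<le> x \<Longrightarrow> x \<le> y \<Longrightarrow> \<gamma> i j x \<le> \<gamma> i j y"
  using gain_cases[of i j] class_K_mono by auto

lemma gain_zero: "\<gamma> i j 0 = 0"
  using gain_cases[of i j] by (auto simp: class_K_def)

lemma apply_gain_op:
  assumes "s \<in> linf_pos"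
  shows "apply_bcontfun (\<Gamma> s) i = gain_seq \<gamma> s i"
  using assms well_defined unfolding gain_op_def gain_well_defined_def
  by (simp add: Bcontfun_inverse bcontfun_nat_iff)

lemma gain_op_pos [intro]: "s \<in> linf_pos \<Longrightarrow> \<Gamma> s \<in> linf_pos"
  using well_defined by (auto simp: linf_pos_def apply_gain_op gain_well_defined_def)

lemma finite_gain_range:
  assumes "s \<in> linf_pos"
  shows "finite (range (\<lambda>j. \<gamma> i j (apply_bcontfun s j)))"
proof (rule finite_subset)
  show "range (\<lambda>j. \<gamma> i j (apply_bcontfun s j)) \<subseteq> insert 0 ((\<lambda>j. \<gamma> i j (apply_bcontfun s j)) ` I i)"
    using assms gain_outside by (fastforce simp: linf_pos_def)
  show "finite (insert 0 ((\<lambda>j. \<gamma> i j (apply_bcontfun s j)) ` I i))"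
    using gains by (simp add: max_type_gains_def)
qed

lemma gain_le:
  assumes "s \<in> linf_pos"
  shows "\<gamma> i j (apply_bcontfun s j) \<le> apply_bcontfun (\<Gamma> s) i"
  unfolding apply_gain_op[OF assms] gain_seq_def
  by (rule cSUP_upper) (auto intro: bdd_above_finite[OF finite_gain_range[OF assms]])

text \<open>Only finitely many terms can be nonzero, so the supremum is a maximum. A positive value
  forces the maximizing index into \<open>I i\<close>, where class K and bi-Lipschitz information is
  available.\<close>

lemma gain_attained:
  assumes "s \<in> linf_pos"
  obtains j where "apply_bcontfun (\<Gamma> s) i = \<gamma> i j (apply_bcontfun s j)"
    "0 < apply_bcontfun (\<Gamma> s) i \<Longrightarrow> j \<in> I i"
proof -
  let ?R = "range (\<lambda>j. \<gamma> i j (apply_bcontfun s j))"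
  have "Sup ?R = Max ?R"
    by (intro cSup_eq_Max finite_gain_range assms) auto
  also have "\<dots> \<in> ?R"
    by (intro Max_in finite_gain_range assms) auto
  finally obtain j where j: "apply_bcontfun (\<Gamma> s) i = \<gamma> i j (apply_bcontfun s j)"
    unfolding apply_gain_op[OF assms] gain_seq_def by auto
  moreover have "j \<in> I i" if "0 < apply_bcontfun (\<Gamma> s) i"
    using that gain_outside[of j i "apply_bcontfun s j"] assms j
    by (force simp: linf_pos_def)
  ultimately show thesis
    using that by blast
qed

lemma gain_op_mono:
  assumes "s \<in> linf_pos" "t \<in> linf_pos" "s \<sqsubseteq> t"
  shows "\<Gamma> s \<sqsubseteq> \<Gamma> t"
  unfolding linf_le_def
proof
  fix i
  obtain j where "apply_bcontfun (\<Gamma> s) i = \<gamma> i j (apply_bcontfun s j)"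
    using gain_attained assms(1) by blast
  also have "\<dots> \<le> \<gamma> i j (apply_bcontfun t j)"
    using assms by (intro gain_mono) (auto simp: linf_pos_def linf_le_def)
  also have "\<dots> \<le> apply_bcontfun (\<Gamma> t) i"
    using assms(2) by (rule gain_le)
  finally show "apply_bcontfun (\<Gamma> s) i \<le> apply_bcontfun (\<Gamma> t) i" .
qed

text \<open>At the attaining index \<open>j\<close> the gain is evaluated at a component of
  \<open>s\<close> or of \<open>t\<close>, so a single gain value is compared with one side of the
  maximum.\<close>

lemma gain_op_max:
  assumes "s \<in> linf_pos" "t \<in> linf_pos"
  shows "\<Gamma> (s \<oplus> t) \<sqsubseteq> \<Gamma> s \<oplus> \<Gamma> t"
  unfolding linf_le_def
proof
  fix i
  obtain j where j: "apply_bcontfun (\<Gamma> (s \<oplus> t)) i = \<gamma> i j (apply_bcontfun (s \<oplus> t) j)"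
    using gain_attained assms by (metis linf_pos_max)
  show "apply_bcontfun (\<Gamma> (s \<oplus> t)) i \<le> apply_bcontfun (\<Gamma> s \<oplus> \<Gamma> t) i"
    using j gain_le[OF assms(1), of i j] gain_le[OF assms(2), of i j] by (auto simp: max_def)
qed

section \<open>Iterates of the gain operator and of its augmented form\<close>

lemma iterate_pos [intro]: "s \<in> linf_pos \<Longrightarrow> (\<Gamma> ^^ k) s \<in> linf_pos"
  by (induction k) auto

lemma augmented_pos [intro]: "s \<in> linf_pos \<Longrightarrow> (augmented \<Gamma> ^^ k) s \<in> linf_pos"
  by (induction k) (auto simp: augmented_def)

lemma apply_augmented_Suc:
  "apply_bcontfun ((augmented \<Gamma> ^^ Suc k) s) i =
     max (apply_bcontfun ((augmented \<Gamma> ^^ k) s) i)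
       (apply_bcontfun (\<Gamma> ((augmented \<Gamma> ^^ k) s)) i)"
  by (simp add: augmented_def[of _ "(augmented \<Gamma> ^^ k) s"])

lemma iterate_le_augmented:
  assumes "s \<in> linf_pos" "m \<le> k"
  shows "(\<Gamma> ^^ m) s \<sqsubseteq> (augmented \<Gamma> ^^ k) s"
  using assms(2)
proof (induction k arbitrary: m)
  case 0
  then show ?case by (simp add: linf_le_def)
next
  case (Suc k)
  show ?case
  proof (cases "m \<le> k")
    case True
    then show ?thesis
      using Suc.IH[of m]
      by (simp add: linf_le_def apply_augmented_Suc le_max_iff_disj del: funpow.simps)
  next
    case False
    then have "m = Suc k" using Suc.prems by simp
    moreover have "\<Gamma> ((\<Gamma> ^^ k) s) \<sqsubseteq> \<Gamma> ((augmented \<Gamma> ^^ k) s)"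
      using assms(1) by (intro gain_op_mono Suc.IH) auto
    ultimately show ?thesis
      unfolding linf_le_def apply_augmented_Suc by (simp add: le_max_iff_disj)
  qed
qed

text \<open>Every maximum selects one of its arguments in each component, so unfolding the augmented
  operator ends in a pure iterate of \<Gamma>; the exponent \<open>m\<close> depends on the
  component. With \<open>iterate_le_augmented\<close>, the augmented orbit is the running maximum of
  the orbit of \<Gamma>.\<close>

lemma augmented_le_iterate:
  assumes "s \<in> linf_pos"
  shows "\<exists>m\<le>k. apply_bcontfun ((augmented \<Gamma> ^^ k) s) i \<le> apply_bcontfun ((\<Gamma> ^^ m) s) i"
proof (induction k arbitrary: i)
  case 0
  then show ?case by simp
next
  case (Suc k)
  let ?A = "(augmented \<Gamma> ^^ k) s"
  obtain j where j: "apply_bcontfun (\<Gamma> ?A) i = \<gamma> i j (apply_bcontfun ?A j)"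
    using gain_attained assms by blast
  obtain m where m: "m \<le> k" "apply_bcontfun ?A j \<le> apply_bcontfun ((\<Gamma> ^^ m) s) j"
    using Suc.IH by blast
  have "\<gamma> i j (apply_bcontfun ?A j) \<le> \<gamma> i j (apply_bcontfun ((\<Gamma> ^^ m) s) j)"
    using m(2) augmented_pos[OF assms, of k] by (intro gain_mono) (auto simp: linf_pos_def)
  also have "\<dots> \<le> apply_bcontfun ((\<Gamma> ^^ Suc m) s) i"
    using gain_le[OF iterate_pos[OF assms]] by simp
  finally have "apply_bcontfun (\<Gamma> ?A) i \<le> apply_bcontfun ((\<Gamma> ^^ Suc m) s) i"
    using j by simp
  moreover obtain m' where m': "m' \<le> k" "apply_bcontfun ?A i \<le> apply_bcontfun ((\<Gamma> ^^ m') s) i"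
    using Suc.IH by blast
  ultimately show ?case
    unfolding apply_augmented_Suc max_def
    using m(1) m'(1) by (cases "apply_bcontfun ?A i \<le> apply_bcontfun (\<Gamma> ?A) i")
      (auto simp del: funpow.simps intro: exI[of _ "Suc m"] exI[of _ m'])
qed

end

section \<open>Decay estimates from UGAS\<close>

locale ugas_gain = max_gain +
  fixes \<beta> :: "real \<Rightarrow> real \<Rightarrow> real"
  assumes KL: "class_KL \<beta>"
    and iterate_bound: "\<And>s k. s \<in> linf_pos \<Longrightarrow> norm ((\<Gamma> ^^ k) s) \<le> \<beta> (norm s) (real k)"
begin

abbreviation \<sigma> :: "real \<Rightarrow> nat \<Rightarrow> real" where
  "\<sigma> r \<equiv> apply_bcontfun (sigma_lower \<Gamma> r)"

lemma KL_K: "0 \<le> t \<Longrightarrow> class_K (\<lambda>r. \<beta> r t)"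
  using KL by (simp add: class_KL_def)

lemma KL_zero: "0 \<le> t \<Longrightarrow> \<beta> 0 t = 0"
  using KL_K by (simp add: class_K_def)

lemma KL_antimono:
  assumes "0 \<le> r" "0 \<le> t" "t \<le> u"
  shows "\<beta> r u \<le> \<beta> r t"
proof (cases "r = 0 \<or> t = u")
  case True
  then show ?thesis using assms by (auto simp: KL_zero)
next
  case False
  then have "strict_antimono_on {0..} (\<beta> r)"
    using KL assms(1) by (simp add: class_KL_def)
  then show ?thesis
    using monotone_onD[of "{0..}" "(<)" "(>)" "\<beta> r" t u] False assms by auto
qed

lemma KL_eventually_less:
  assumes "0 \<le> r" "0 < \<epsilon>"
  shows "\<exists>N. \<forall>n\<ge>N. \<beta> r (real n) < \<epsilon>"
\<comment> \<open>\<open>class_KL\<close> provides decay in time only for positive \<open>r\<close>;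
  at 0 the bound vanishes.\<close>
proof (cases "r = 0")
  case True
  then show ?thesis using assms by (simp add: KL_zero)
next
  case False
  then have "(\<beta> r \<longlongrightarrow> 0) at_top"
    using KL assms(1) by (simp add: class_KL_def)
  then have "(\<lambda>n. \<beta> r (real n)) \<longlonglongrightarrow> 0"
    using filterlim_compose filterlim_real_sequentially by blast
  then have "\<forall>\<^sub>F n in sequentially. \<beta> r (real n) < \<epsilon>"
    using assms(2) by (rule order_tendstoD)
  then show ?thesis by (simp add: eventually_sequentially)
qed

lemma iterate_const_bound:
  assumes "0 \<le> r"
  shows "apply_bcontfun ((\<Gamma> ^^ k) (const_bcontfun r)) i \<le> \<beta> r (real k)"
  using apply_le_norm[of "(\<Gamma> ^^ k) (const_bcontfun r)" i]
    iterate_bound[of "const_bcontfun r" k] assms by (simp add: norm_const_linf)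

text \<open>This is the UGAS estimate at time 0 for a constant sequence; it yields unboundedness of
  \<open>\<beta> r 0\<close> in \<open>r\<close>.\<close>

lemma le_KL_0: "0 \<le> r \<Longrightarrow> r \<le> \<beta> r 0"
  using iterate_const_bound[of r 0] by simp

lemma KL_Kinf: "class_Kinf (\<lambda>r. \<beta> r 0)"
  by (rule class_KinfI) (auto intro: KL_K le_KL_0)

section \<open>Boundedness of the augmented orbit and attainment of its supremum\<close>

lemma augmented_const_bound:
  assumes "0 \<le> r"
  shows "apply_bcontfun ((augmented \<Gamma> ^^ k) (const_bcontfun r)) i \<le> \<beta> r 0"
proof -
  obtain m where "apply_bcontfun ((augmented \<Gamma> ^^ k) (const_bcontfun r)) i
      \<le> apply_bcontfun ((\<Gamma> ^^ m) (const_bcontfun r)) i"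
    using augmented_le_iterate[of "const_bcontfun r"] assms by auto
  also have "\<dots> \<le> \<beta> r (real m)"
    using assms by (rule iterate_const_bound)
  also have "\<dots> \<le> \<beta> r 0"
    using assms by (intro KL_antimono) auto
  finally show ?thesis .
qed

lemma augmented_const_nonneg:
  "0 \<le> r \<Longrightarrow> 0 \<le> apply_bcontfun ((augmented \<Gamma> ^^ k) (const_bcontfun r)) i"
  using augmented_pos[of "const_bcontfun r"] by (simp add: linf_pos_def)

text \<open>This is the condition under which \<open>sigma_lower\<close> denotes the intended
  supremum; it is also one of the final conclusions.\<close>

lemma bounded_augmented_orbit:
  assumes "0 \<le> r"
  shows "bounded (range (\<lambda>k. (augmented \<Gamma> ^^ k) (const_bcontfun r)))"
  unfolding bounded_iff
proof (intro exI ballI)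
  fix x assume "x \<in> range (\<lambda>k. (augmented \<Gamma> ^^ k) (const_bcontfun r))"
  then show "norm x \<le> \<beta> r 0"
    using augmented_const_bound[OF assms] augmented_const_nonneg[OF assms]
    by (auto intro!: norm_bound)
qed

lemma bdd_above_augmented:
  "0 \<le> r \<Longrightarrow> bdd_above (range (\<lambda>k. apply_bcontfun ((augmented \<Gamma> ^^ k) (const_bcontfun r)) i))"
  by (rule bdd_aboveI2[OF augmented_const_bound])

text \<open>The bound \<open>\<beta> r 0\<close> does not depend on the component, so the sequence
  of suprema is bounded and \<open>Bcontfun\<close> can be unwrapped.\<close>

lemma sigma_eq:
  assumes "0 \<le> r"
  shows "\<sigma> r i = (SUP k. apply_bcontfun ((augmented \<Gamma> ^^ k) (const_bcontfun r)) i)"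
proof -
  let ?f = "\<lambda>i. SUP k. apply_bcontfun ((augmented \<Gamma> ^^ k) (const_bcontfun r)) i"
  have "norm (?f i) \<le> \<beta> r 0" for i
  proof -
    have "0 \<le> ?f i"
      using augmented_const_nonneg[OF assms, of 0 i] bdd_above_augmented[OF assms, of i]
      by (rule cSUP_upper2[rotated 2]) auto
    moreover have "?f i \<le> \<beta> r 0"
      using augmented_const_bound[OF assms] by (intro cSUP_least) auto
    ultimately show ?thesis by simp
  qed
  then have "bounded (range ?f)"
    by (auto simp: bounded_iff)
  then show ?thesis
    by (simp add: sigma_lower_def Bcontfun_inverse bcontfun_nat_iff)
qed

lemma augmented_le_sigma:
  "0 \<le> r \<Longrightarrow> apply_bcontfun ((augmented \<Gamma> ^^ k) (const_bcontfun r)) i \<le> \<sigma> r i"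
  unfolding sigma_eq by (intro cSUP_upper bdd_above_augmented) auto

lemma sigma_bound: "0 \<le> r \<Longrightarrow> \<sigma> r i \<le> \<beta> r 0"
  unfolding sigma_eq by (intro cSUP_least augmented_const_bound) auto

lemma iterate_le_sigma:
  assumes "0 \<le> r"
  shows "apply_bcontfun ((\<Gamma> ^^ k) (const_bcontfun r)) i \<le> \<sigma> r i"
  using linf_leD[OF iterate_le_augmented[of "const_bcontfun r" k k]] augmented_le_sigma[OF assms] assms
  by (meson linf_pos_const order.refl order.trans)

lemma le_sigma: "0 \<le> r \<Longrightarrow> r \<le> \<sigma> r i"
  using iterate_le_sigma[of r 0] by simp

lemma sigma_pos [intro]: "0 \<le> r \<Longrightarrow> sigma_lower \<Gamma> r \<in> linf_pos"
  using le_sigma by (auto simp: linf_pos_def intro: order.trans)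

lemma sigma_zero: "\<sigma> 0 i = 0"
  using sigma_bound[of 0 i] le_sigma[of 0 i] by (simp add: KL_zero)

text \<open>On a compact interval the supremum runs over finitely many iterates, uniformly in the
  component: the tail of the orbit of \<open>r\<one>\<close> drops below \<open>r\<close>, its value at time \<open>0\<close>.\<close>

lemma sigma_attained:
  assumes "0 < a"  "a \<le> b"
  obtains N where "\<And>r i. a \<le> r \<Longrightarrow> r \<le> b \<Longrightarrow>
    \<exists>m\<le>N. \<sigma> r i = apply_bcontfun ((\<Gamma> ^^ m) (const_bcontfun r)) i"
proof -
  \<comment> \<open>One \<open>N\<close> serves the whole interval, since
    \<open>\<beta> r n \<le> \<beta> b n < a \<le> r\<close> for \<open>n \<ge> N\<close>.\<close>
  obtain N where N: "\<And>n. n \<ge> N \<Longrightarrow> \<beta> b (real n) < a"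
    using KL_eventually_less[of b a] assms by auto
  have "\<exists>m\<le>N. \<sigma> r i = apply_bcontfun ((\<Gamma> ^^ m) (const_bcontfun r)) i" if r: "a \<le> r" "r \<le> b" for r i
  proof -
    have r0: "0 \<le> r" using assms r by simp
    have pos: "const_bcontfun r \<in> linf_pos" using r0 by simp
    have "\<sigma> r i \<le> apply_bcontfun ((augmented \<Gamma> ^^ N) (const_bcontfun r)) i"
      unfolding sigma_eq[OF r0]
    proof (rule cSUP_least)
      fix k
      obtain m where m: "apply_bcontfun ((augmented \<Gamma> ^^ k) (const_bcontfun r)) i
          \<le> apply_bcontfun ((\<Gamma> ^^ m) (const_bcontfun r)) i"
        using augmented_le_iterate[OF pos] by blast
      have "\<exists>m'\<le>N. apply_bcontfun ((\<Gamma> ^^ m) (const_bcontfun r)) i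
          \<le> apply_bcontfun ((\<Gamma> ^^ m') (const_bcontfun r)) i"
      proof (cases "m \<le> N")
        case False
        have "apply_bcontfun ((\<Gamma> ^^ m) (const_bcontfun r)) i \<le> \<beta> r (real m)"
          using r0 by (rule iterate_const_bound)
        also have "\<dots> \<le> \<beta> b (real m)"
          using r r0 class_K_mono[OF KL_K] by simp
        also have "\<dots> \<le> r"
          using N[of m] False r by simp
        \<comment> \<open>The iterate at time 0 has the value \<open>r\<close> and already dominates
          the tail.\<close>
        finally show ?thesis
          by (intro exI[of _ 0]) simp
      qed auto
      then show "apply_bcontfun ((augmented \<Gamma> ^^ k) (const_bcontfun r)) i
          \<le> apply_bcontfun ((augmented \<Gamma> ^^ N) (const_bcontfun r)) i"
        using m linf_leD[OF iterate_le_augmented[OF pos]] by (meson order.trans)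
    qed auto
    moreover obtain m where "m \<le> N" "apply_bcontfun ((augmented \<Gamma> ^^ N) (const_bcontfun r)) i
        \<le> apply_bcontfun ((\<Gamma> ^^ m) (const_bcontfun r)) i"
      using augmented_le_iterate[OF pos] by blast
    ultimately show ?thesis
      using iterate_le_sigma[OF r0, of m i] by (intro exI[of _ m]) linarith
  qed
  then show thesis by (rule that)
qed

section \<open>The supremum as a fixed point of \<open>gain_from\<close>\<close>

text \<open>At the index attaining the gain, \<open>\<sigma> r j\<close> is the value of some
  iterate \<open>m\<close>; applying the gain stays below iterate \<open>m + 1\<close>, hence below
  \<open>\<sigma> r i\<close>. Attainment is available only for positive \<open>r\<close>, so 0 is
  treated separately.\<close>

lemma gain_sigma_le:
  assumes "0 \<le> r"
  shows "\<Gamma> (sigma_lower \<Gamma> r) \<sqsubseteq> sigma_lower \<Gamma> r"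
  unfolding linf_le_def
proof
  fix i
  obtain j where j: "apply_bcontfun (\<Gamma> (sigma_lower \<Gamma> r)) i = \<gamma> i j (\<sigma> r j)"
    using gain_attained assms by blast
  show "apply_bcontfun (\<Gamma> (sigma_lower \<Gamma> r)) i \<le> \<sigma> r i"
  proof (cases "r = 0")
    case True
    then show ?thesis using j by (simp add: sigma_zero gain_zero)
  next
    case False
    then obtain m where "\<sigma> r j = apply_bcontfun ((\<Gamma> ^^ m) (const_bcontfun r)) j"
      using sigma_attained[of r r] assms by (metis order.refl order_less_le)
    then have "\<gamma> i j (\<sigma> r j) \<le> apply_bcontfun ((\<Gamma> ^^ Suc m) (const_bcontfun r)) i"
      using gain_le[OF iterate_pos[of "const_bcontfun r"]] assms by simp
    also have "\<dots> \<le> \<sigma> r i"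
      using assms by (rule iterate_le_sigma)
    finally show ?thesis using j by simp
  qed
qed

text \<open>The optimal iterate is either at time 0, with value \<open>r\<close>, or \<Gamma> of an
  iterate below \<sigma>. Together with \<open>gain_sigma_le\<close> and \<open>le_sigma\<close>
  this gives the fixed-point equation; it is also the premise of the MBI implication for the
  constant input \<open>r\<close>.\<close>

lemma sigma_le_gain_from:
  assumes "0 \<le> r"
  shows "sigma_lower \<Gamma> r \<sqsubseteq> gain_from \<Gamma> r (sigma_lower \<Gamma> r)"
  unfolding linf_le_def
proof
  fix i
  show "\<sigma> r i \<le> apply_bcontfun (gain_from \<Gamma> r (sigma_lower \<Gamma> r)) i"
  proof (cases "r = 0")
    case True
    then show ?thesis by (simp add: sigma_zero gain_from_def)
  next
    case False
    then obtain m where m: "\<sigma> r i = apply_bcontfun ((\<Gamma> ^^ m) (const_bcontfun r)) i"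
      using sigma_attained[of r r] assms by (metis order.refl order_less_le)
    show ?thesis
    proof (cases m)
      case 0
      then show ?thesis using m by (simp add: gain_from_def)
    next
      case (Suc k)
      have "\<Gamma> ((\<Gamma> ^^ k) (const_bcontfun r)) \<sqsubseteq> \<Gamma> (sigma_lower \<Gamma> r)"
        using assms iterate_le_sigma[OF assms] by (intro gain_op_mono) (auto simp: linf_le_def)
      then show ?thesis
        using m Suc by (auto simp: gain_from_def linf_le_def le_max_iff_disj)
    qed
  qed
qed

section \<open>Admissible functions and the equality of the two constructions\<close>

text \<open>The sequence \<open>sigma_lower \<Gamma> (norm b)\<close> dominates \<open>b\<close> and
  is not increased by \<Gamma>, so it absorbs every contribution of \<open>b\<close> when the
  premise is iterated. What remains of \<open>s\<close> is \<open>(\<Gamma> ^^ n) s\<close>, which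
  tends to 0.\<close>

lemma admissible_KL: "admissible \<Gamma> (\<lambda>r. \<beta> r 0)"
  unfolding admissible_def
proof (intro conjI ballI impI KL_Kinf)
  fix s b assume s: "s \<in> linf_pos" and b: "b \<in> linf_pos" and le: "s \<sqsubseteq> \<Gamma> s \<oplus> b"
  let ?S = "sigma_lower \<Gamma> (norm b)"
  have S: "?S \<in> linf_pos" by auto
  have iter: "s \<sqsubseteq> (\<Gamma> ^^ n) s \<oplus> ?S" for n
  proof (induction n)
    case 0
    then show ?case by (simp add: linf_le_def)
  next
    case (Suc n)
    have "\<Gamma> s \<sqsubseteq> \<Gamma> ((\<Gamma> ^^ n) s \<oplus> ?S)"
      using s S Suc by (intro gain_op_mono) auto
    moreover have "\<Gamma> ((\<Gamma> ^^ n) s \<oplus> ?S) \<sqsubseteq> \<Gamma> ((\<Gamma> ^^ n) s) \<oplus> \<Gamma> ?S"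
      using s S by (intro gain_op_max) auto
    moreover have "\<Gamma> ?S \<sqsubseteq> ?S"
      by (rule gain_sigma_le) simp
    moreover have "apply_bcontfun b i \<le> apply_bcontfun ?S i" for i
      using apply_le_norm[of b i] le_sigma[of "norm b" i] by simp
    ultimately show ?case
      using le unfolding linf_le_def by (simp add: le_max_iff_disj) (smt (verit))
  qed
  show "norm s \<le> \<beta> (norm b) 0"
  proof (rule norm_bound)
    fix i
    have "apply_bcontfun s i \<le> \<sigma> (norm b) i + \<epsilon>" if "0 < \<epsilon>" for \<epsilon>
    proof -
      obtain n where n: "\<beta> (norm s) (real n) < \<epsilon>"
        using KL_eventually_less[of "norm s" \<epsilon>] \<open>0 < \<epsilon>\<close> by auto
      have "apply_bcontfun ((\<Gamma> ^^ n) s) i < \<epsilon>"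
        using apply_le_norm[of "(\<Gamma> ^^ n) s" i] iterate_bound[OF s, of n] n by linarith
      moreover have "0 \<le> \<sigma> (norm b) i"
        using S by (simp add: linf_pos_def)
      ultimately show ?thesis
        using linf_leD[OF iter[of n], of i] that by (auto simp: le_max_iff_disj)
    qed
    then have "apply_bcontfun s i \<le> \<sigma> (norm b) i"
      by (rule field_le_epsilon)
    then show "norm (apply_bcontfun s i) \<le> \<beta> (norm b) 0"
      using s sigma_bound[of "norm b" i] by (simp add: linf_pos_def)
  qed
qed

lemma sigma_lower_eq_upper:
  assumes \<phi>: "admissible \<Gamma> \<phi>" and r: "0 \<le> r"
  shows "\<sigma> r i = sigma_upper \<Gamma> \<phi> r i"
proof -
  let ?S = "sigma_lower \<Gamma> r"
  let ?U = "\<lambda>n. (gain_from \<Gamma> r ^^ n) (const_bcontfun (\<phi> r))"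
  have S: "?S \<in> linf_pos" using r by auto
  \<comment> \<open>The MBI property with the constant input \<open>r\<close> places
    \<open>?S\<close> below the starting sequence of the upper iteration.\<close>
  have "norm ?S \<le> \<phi> (norm (const_bcontfun r :: linf))"
    using \<phi> S r sigma_le_gain_from[OF r]
    unfolding admissible_def gain_from_def linf_le_def by (auto simp: max.commute)
  then have norm_S: "norm ?S \<le> \<phi> r"
    using r by (simp add: norm_const_linf)
  then have \<phi>r: "0 \<le> \<phi> r"
    using norm_ge_zero order.trans by blast
  have U_pos: "?U n \<in> linf_pos" for n
    using \<phi>r r by (induction n) (auto simp: gain_from_def)
  have lower: "?S \<sqsubseteq> ?U n" for n
  proof (induction n)
    case 0
    then show ?case
      using norm_S apply_le_norm[of ?S] by (auto simp: linf_le_def intro: order.trans)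
  next
    case (Suc n)
    have "\<Gamma> ?S \<sqsubseteq> \<Gamma> (?U n)"
      using S U_pos Suc by (intro gain_op_mono)
    then show ?case
      using sigma_le_gain_from[OF r] unfolding linf_le_def gain_from_def
      by (simp add: le_max_iff_disj) (meson order.trans)
  qed
  \<comment> \<open>The maximum splits under \<Gamma>: the first part is a transient that decays by
    UGAS, while \<open>?S\<close> persists because it dominates both \<open>r\<close> and
    \<open>\<Gamma> ?S\<close>.\<close>
  have upper: "?U n \<sqsubseteq> (\<Gamma> ^^ n) (const_bcontfun (\<phi> r)) \<oplus> ?S" for n
  proof (induction n)
    case 0
    then show ?case by (simp add: linf_le_def)
  next
    case (Suc n)
    let ?P = "(\<Gamma> ^^ n) (const_bcontfun (\<phi> r))"
    have P: "?P \<in> linf_pos" using \<phi>r by auto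
    have "\<Gamma> (?U n) \<sqsubseteq> \<Gamma> (?P \<oplus> ?S)"
      using S P U_pos Suc by (intro gain_op_mono) auto
    moreover have "\<Gamma> (?P \<oplus> ?S) \<sqsubseteq> \<Gamma> ?P \<oplus> \<Gamma> ?S"
      using P S by (intro gain_op_max)
    moreover have "\<Gamma> ?S \<sqsubseteq> ?S"
      using r by (rule gain_sigma_le)
    moreover have "r \<le> \<sigma> r i" for i
      using r by (rule le_sigma)
    ultimately show ?case
      unfolding linf_le_def gain_from_def by (simp add: le_max_iff_disj) (smt (verit))
  qed
  show ?thesis
    unfolding sigma_upper_def
  proof (rule antisym)
    show "\<sigma> r i \<le> (INF n. apply_bcontfun (?U n) i)"
      using linf_leD[OF lower] by (intro cINF_greatest) auto
    show "(INF n. apply_bcontfun (?U n) i) \<le> \<sigma> r i"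
    proof (rule field_le_epsilon)
      fix \<epsilon> :: real assume "0 < \<epsilon>"
      then obtain n where n: "\<beta> (\<phi> r) (real n) < \<epsilon>"
        using KL_eventually_less[OF \<phi>r] by auto
      have "(INF n. apply_bcontfun (?U n) i) \<le> apply_bcontfun (?U n) i"
        using linf_leD[OF lower] by (intro cINF_lower bdd_belowI2) auto
      also have "\<dots> \<le> max (\<beta> (\<phi> r) (real n)) (\<sigma> r i)"
        using linf_leD[OF upper, of n i] iterate_const_bound[OF \<phi>r, of n i] by auto
      also have "\<dots> \<le> \<sigma> r i + \<epsilon>"
        using n \<open>0 < \<epsilon>\<close> le_sigma[OF r, of i] r by auto
      finally show "(INF n. apply_bcontfun (?U n) i) \<le> \<sigma> r i + \<epsilon>" .
    qed
  qed
qed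

section \<open>Optimal paths and bi-Lipschitz bounds for the components\<close>

text \<open>The remainder of an optimal path is optimal: if \<open>\<sigma> r j\<close> exceeded the
  iterate \<open>k\<close> at \<open>j\<close>, strict monotonicity of the gain would make
  \<open>\<gamma> i j (\<sigma> r j)\<close> exceed \<open>\<sigma> r i\<close>, against
  \<open>gain_sigma_le\<close>.\<close>

lemma sigma_optimal_step:
  assumes r: "0 < r" and eq: "\<sigma> r i = apply_bcontfun ((\<Gamma> ^^ Suc k) (const_bcontfun r)) i"
  obtains j where "j \<in> I i" "\<sigma> r i = \<gamma> i j (\<sigma> r j)"
    "\<sigma> r j = apply_bcontfun ((\<Gamma> ^^ k) (const_bcontfun r)) j"
proof -
  let ?P = "(\<Gamma> ^^ k) (const_bcontfun r)"
  have P: "?P \<in> linf_pos" using r by auto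
  have "0 < \<sigma> r i" using le_sigma[of r i] r by simp
  then obtain j where j: "j \<in> I i" "\<sigma> r i = \<gamma> i j (apply_bcontfun ?P j)"
    using gain_attained[OF P, of i] eq by auto
  have P0: "0 \<le> apply_bcontfun ?P j" using P by (simp add: linf_pos_def)
  have le: "apply_bcontfun ?P j \<le> \<sigma> r j"
    using r by (intro iterate_le_sigma) simp
  have "\<gamma> i j (\<sigma> r j) \<le> apply_bcontfun (\<Gamma> (sigma_lower \<Gamma> r)) i"
    using r by (intro gain_le) auto
  also have "\<dots> \<le> \<sigma> r i"
    using r gain_sigma_le[of r] by (simp add: linf_le_def)
  finally have no_gap: "\<gamma> i j (\<sigma> r j) \<le> \<gamma> i j (apply_bcontfun ?P j)"
    using j(2) by simp
  have "class_K (\<gamma> i j)"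
    using gain_cases[of i j] j(2) P0 \<open>0 < \<sigma> r i\<close> by auto
  then have "strict_mono_on {0..} (\<gamma> i j)"
    by (simp add: class_K_def)
  then have "\<sigma> r j = apply_bcontfun ?P j"
    using strict_mono_onD[of "{0..}" "\<gamma> i j" "apply_bcontfun ?P j" "\<sigma> r j"] le P0 no_gap by force
  then show thesis using that j by auto
qed

lemma gain_sigma_component_le: "0 \<le> r \<Longrightarrow> \<gamma> i j (\<sigma> r j) \<le> \<sigma> r i"
  using gain_le[OF sigma_pos] linf_leD[OF gain_sigma_le] order.trans by blast

end

locale bilipschitz_gain = ugas_gain +
  assumes bilipschitz: "\<And>a b. 0 < a \<Longrightarrow> a \<le> b \<Longrightarrow>
      \<exists>l L. 0 < l \<and> l < L \<and>
        (\<forall>i. \<forall>j\<in>I i. \<forall>r1\<in>{a..b}. \<forall>r2\<in>{a..b}.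
           l * \<bar>r1 - r2\<bar> \<le> \<bar>\<gamma> i j r1 - \<gamma> i j r2\<bar> \<and>
           \<bar>\<gamma> i j r1 - \<gamma> i j r2\<bar> \<le> L * \<bar>r1 - r2\<bar>)"
begin

text \<open>The difference of two values of \<open>\<sigma>\<^sub>i\<close> is propagated along the path of indices on which
  \<open>\<sigma>\<^sub>i\<close> is attained at one of the two arguments. Since \<open>\<sigma>\<^sub>j r \<ge> r\<close>, all values met on the way stay
  in one compact interval away from \<open>0\<close>.\<close>

lemma sigma_bilipschitz:
  assumes ab: "0 < a" "a \<le> b"
  obtains c C where "0 < c" "c \<le> C"
    "\<And>i r1 r2. a \<le> r1 \<Longrightarrow> r1 \<le> r2 \<Longrightarrow> r2 \<le> b \<Longrightarrow>
       c * (r2 - r1) \<le> \<sigma> r2 i - \<sigma> r1 i \<and> \<sigma> r2 i - \<sigma> r1 i \<le> C * (r2 - r1)"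
proof -
  \<comment> \<open>\<open>M\<close> bounds all components on the interval, so every gain argument
    met along a path lies in \<open>{a..M}\<close>.\<close>
  define M where "M = \<beta> b 0"
  have aM: "a \<le> M" using le_KL_0[of b] ab by (simp add: M_def)
  have sigma_range: "a \<le> \<sigma> r i" "\<sigma> r i \<le> M" if "a \<le> r" "r \<le> b" for r i
  proof -
    show "a \<le> \<sigma> r i" using le_sigma[of r i] that ab by simp
    show "\<sigma> r i \<le> M"
      using sigma_bound[of r i] class_K_mono[OF KL_K[of 0], of r b] that ab by (simp add: M_def)
  qed
  obtain l L where l: "0 < l"
    and lip: "\<And>i j r1 r2. \<lbrakk>j \<in> I i; r1 \<in> {a..M}; r2 \<in> {a..M}\<rbrakk> \<Longrightarrow>
      l * \<bar>r1 - r2\<bar> \<le> \<bar>\<gamma> i j r1 - \<gamma> i j r2\<bar> \<and> \<bar>\<gamma> i j r1 - \<gamma> i j r2\<bar> \<le> L * \<bar>r1 - r2\<bar>"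
    using bilipschitz[OF ab(1) aM] by blast
  \<comment> \<open>Capping at 1 makes \<open>p ^ k\<close> nonincreasing and \<open>q ^ k\<close>
    nondecreasing in \<open>k\<close>, so the exponent \<open>N\<close> covers all shorter
    paths.\<close>
  define p q where "p = min 1 l" and "q = max 1 L"
  have p: "0 < p" "p \<le> 1" "p \<le> l" and q: "1 \<le> q" "L \<le> q"
    using l by (auto simp: p_def q_def)
  have step: "p * (y - x) \<le> \<gamma> i j y - \<gamma> i j x" "\<gamma> i j y - \<gamma> i j x \<le> q * (y - x)"
    if "j \<in> I i" "a \<le> x" "x \<le> y" "y \<le> M" for i j x y
  proof -
    have "\<bar>\<gamma> i j y - \<gamma> i j x\<bar> = \<gamma> i j y - \<gamma> i j x"
      using gain_mono[of x y i j] that ab by simp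
    then have "l * (y - x) \<le> \<gamma> i j y - \<gamma> i j x" "\<gamma> i j y - \<gamma> i j x \<le> L * (y - x)"
      using lip[of j i y x] that by auto
    moreover have "p * (y - x) \<le> l * (y - x)" "L * (y - x) \<le> q * (y - x)"
      using p q that by (auto intro: mult_right_mono)
    ultimately show "p * (y - x) \<le> \<gamma> i j y - \<gamma> i j x" "\<gamma> i j y - \<gamma> i j x \<le> q * (y - x)"
      by linarith+
  qed
  \<comment> \<open>The path is optimal at the smaller argument; at \<open>r2\<close> the same gains
    still bound \<sigma> from below, which is the direction required.\<close>
  have lower: "p ^ k * (r2 - r1) \<le> \<sigma> r2 i - \<sigma> r1 i"
    if r: "a \<le> r1" "r1 \<le> r2" "r2 \<le> b" and "\<sigma> r1 i = apply_bcontfun ((\<Gamma> ^^ k) (const_bcontfun r1)) i"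
    for k i r1 r2
    using that(4)
  proof (induction k arbitrary: i)
    case 0
    then show ?case using le_sigma[of r2 i] r ab by simp
  next
    case (Suc k)
    obtain j where j: "j \<in> I i" "\<sigma> r1 i = \<gamma> i j (\<sigma> r1 j)"
      "\<sigma> r1 j = apply_bcontfun ((\<Gamma> ^^ k) (const_bcontfun r1)) j"
      using sigma_optimal_step[OF _ Suc.prems] r ab by auto
    have IH: "p ^ k * (r2 - r1) \<le> \<sigma> r2 j - \<sigma> r1 j"
      using Suc.IH j(3) .
    \<comment> \<open>The ordering required by \<open>step\<close> is extracted from the induction
      hypothesis itself.\<close>
    then have mono: "\<sigma> r1 j \<le> \<sigma> r2 j"
      using p r by (smt (verit) mult_nonneg_nonneg zero_le_power)
    have "p ^ Suc k * (r2 - r1) \<le> p * (\<sigma> r2 j - \<sigma> r1 j)"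
      using mult_left_mono[OF IH, of p] p by (simp add: mult.assoc)
    also have "\<dots> \<le> \<gamma> i j (\<sigma> r2 j) - \<gamma> i j (\<sigma> r1 j)"
      using mono r by (intro step[OF j(1)] sigma_range) auto
    also have "\<dots> \<le> \<sigma> r2 i - \<sigma> r1 i"
      using gain_sigma_component_le[of r2 i j] j(2) r ab by simp
    finally show ?case .
  qed
  \<comment> \<open>Now the path is optimal at the larger argument. This induction does not yield
    the ordering, so it is assumed here and later supplied by the lower bound.\<close>
  have upper: "\<sigma> r2 i - \<sigma> r1 i \<le> q ^ k * (r2 - r1)"
    if r: "a \<le> r1" "r1 \<le> r2" "r2 \<le> b" and mono: "\<And>i. \<sigma> r1 i \<le> \<sigma> r2 i"
      and "\<sigma> r2 i = apply_bcontfun ((\<Gamma> ^^ k) (const_bcontfun r2)) i"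
    for k i r1 r2
    using that(5)
  proof (induction k arbitrary: i)
    case 0
    then show ?case using le_sigma[of r1 i] r ab by simp
  next
    case (Suc k)
    obtain j where j: "j \<in> I i" "\<sigma> r2 i = \<gamma> i j (\<sigma> r2 j)"
      "\<sigma> r2 j = apply_bcontfun ((\<Gamma> ^^ k) (const_bcontfun r2)) j"
      using sigma_optimal_step[OF _ Suc.prems] r ab by auto
    have "\<sigma> r2 i - \<sigma> r1 i \<le> \<gamma> i j (\<sigma> r2 j) - \<gamma> i j (\<sigma> r1 j)"
      using gain_sigma_component_le[of r1 i j] j(2) r ab by simp
    also have "\<dots> \<le> q * (\<sigma> r2 j - \<sigma> r1 j)"
      using mono r by (intro step[OF j(1)] sigma_range) auto
    also have "\<dots> \<le> q ^ Suc k * (r2 - r1)"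
      using mult_left_mono[OF Suc.IH[OF j(3)], of q] q by (simp add: mult.assoc)
    finally show ?case .
  qed
  obtain N where N: "\<And>r i. a \<le> r \<Longrightarrow> r \<le> b \<Longrightarrow>
      \<exists>m\<le>N. \<sigma> r i = apply_bcontfun ((\<Gamma> ^^ m) (const_bcontfun r)) i"
    using sigma_attained[OF ab] by blast
  show thesis
  proof (rule that[of "p ^ N" "q ^ N"])
    show "0 < p ^ N" using p by simp
    show "p ^ N \<le> q ^ N" using p q by (intro power_mono) auto
    fix i r1 r2 assume r: "a \<le> r1" "r1 \<le> r2" "r2 \<le> b"
    have low: "p ^ N * (r2 - r1) \<le> \<sigma> r2 i - \<sigma> r1 i" for i
    proof -
      obtain m where m: "m \<le> N" "\<sigma> r1 i = apply_bcontfun ((\<Gamma> ^^ m) (const_bcontfun r1)) i"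
        using N[of r1 i] r by auto
      have "p ^ N * (r2 - r1) \<le> p ^ m * (r2 - r1)"
        using p r m by (intro mult_right_mono power_decreasing) auto
      then show ?thesis using lower[OF r m(2)] by simp
    qed
    have mono: "\<sigma> r1 i \<le> \<sigma> r2 i" for i
      using low[of i] p r by (smt (verit) mult_nonneg_nonneg zero_le_power)
    obtain m where m: "m \<le> N" "\<sigma> r2 i = apply_bcontfun ((\<Gamma> ^^ m) (const_bcontfun r2)) i"
      using N[of r2 i] r by auto
    have "q ^ m * (r2 - r1) \<le> q ^ N * (r2 - r1)"
      using q r m by (intro mult_right_mono power_increasing) auto
    then show "p ^ N * (r2 - r1) \<le> \<sigma> r2 i - \<sigma> r1 i \<and> \<sigma> r2 i - \<sigma> r1 i \<le> q ^ N * (r2 - r1)"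
      using low upper[OF r mono m(2)] by simp
  qed
qed

section \<open>The components as unbounded comparison functions\<close>

lemma sigma_strict_mono: "strict_mono_on {0..} (\<lambda>r. \<sigma> r i)"
proof (rule strict_mono_onI)
  fix r s :: real assume rs: "r \<in> {0..}" "s \<in> {0..}" "r < s"
  show "\<sigma> r i < \<sigma> s i"
  proof (cases "r = 0")
    case True
    then show ?thesis using le_sigma[of s i] rs by (simp add: sigma_zero)
  next
    case False
    obtain c where c: "0 < c" "c * (s - r) \<le> \<sigma> s i - \<sigma> r i"
      using sigma_bilipschitz[of r s] rs False by (metis atLeast_iff order.refl order_less_le)
    moreover have "0 < c * (s - r)" using c rs by simp
    ultimately show ?thesis by linarith
  qed
qed

text \<open>Bi-Lipschitz bounds are available only away from 0, where they give local Lipschitz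
  continuity. At 0 the component is squeezed between 0 and \<open>\<beta> r 0\<close>.\<close>

lemma sigma_continuous: "continuous_on {0..} (\<lambda>r. \<sigma> r i)"
  unfolding continuous_on_eq_continuous_within
proof
  fix x :: real assume "x \<in> {0..}"
  then consider "x = 0" | "0 < x" by force
  then show "continuous (at x within {0..}) (\<lambda>r. \<sigma> r i)"
  proof cases
    case 1
    have upper: "((\<lambda>r. \<beta> r 0) \<longlongrightarrow> 0) (at 0 within {0..})"
      using KL_K[of 0] unfolding class_K_def continuous_on_def
      by (metis atLeast_iff order.refl)
    have "\<forall>\<^sub>F r in at 0 within {0..}. 0 \<le> \<sigma> r i"
      unfolding eventually_at using le_sigma
      by (intro exI[of _ 1]) (auto intro: order.trans)
    moreover have "\<forall>\<^sub>F r in at 0 within {0..}. \<sigma> r i \<le> \<beta> r 0"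
      unfolding eventually_at using sigma_bound by (intro exI[of _ 1]) auto
    ultimately have "((\<lambda>r. \<sigma> r i) \<longlongrightarrow> 0) (at 0 within {0..})"
      by (rule tendsto_sandwich[OF _ _ tendsto_const upper])
    then show ?thesis using 1 by (simp add: continuous_within sigma_zero)
  next
    case 2
    then have nbhd: "0 < x / 2" "x / 2 \<le> x + 1" by auto
    obtain c C where C: "0 < c" "c \<le> C" "\<And>i r1 r2. x / 2 \<le> r1 \<Longrightarrow> r1 \<le> r2 \<Longrightarrow> r2 \<le> x + 1 \<Longrightarrow>
       c * (r2 - r1) \<le> \<sigma> r2 i - \<sigma> r1 i \<and> \<sigma> r2 i - \<sigma> r1 i \<le> C * (r2 - r1)"
      using sigma_bilipschitz[OF nbhd] by blast
    have "C-lipschitz_on {x / 2..x + 1} (\<lambda>r. \<sigma> r i)"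
    proof (rule lipschitz_on_leI)
      fix r s assume "r \<in> {x / 2..x + 1}" "s \<in> {x / 2..x + 1}" "r \<le> s"
      moreover from this have "0 \<le> c * (s - r)" using C(1) by simp
      ultimately show "dist (\<sigma> r i) (\<sigma> s i) \<le> C * dist r s"
        using C(3)[of r s i] by (simp add: dist_real_def)
    qed (use C in auto)
    then have "continuous_on {x / 2..x + 1} (\<lambda>r. \<sigma> r i)"
      by (rule lipschitz_on_continuous_on)
    moreover have "x \<in> interior {x / 2..x + 1}"
      using 2 by simp
    ultimately have "continuous (at x) (\<lambda>r. \<sigma> r i)"
      by (rule continuous_on_interior)
    then show ?thesis by (rule continuous_at_imp_continuous_within)
  qed
qed

lemma sigma_Kinf: "class_Kinf (\<lambda>r. \<sigma> r i)"
  by (rule class_KinfI)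
    (auto simp: class_K_def sigma_zero intro: sigma_continuous sigma_strict_mono le_sigma)

section \<open>Inverses of the components\<close>

text \<open>Since \<open>\<sigma> 0 i = 0\<close> and \<open>y \<le> \<sigma> y i\<close>, the
  intermediate value theorem on \<open>{0..y}\<close> provides a preimage.\<close>

lemma sigma_inverse:
  assumes "0 \<le> y"
  shows "0 \<le> inv_into {0..} (\<lambda>r. \<sigma> r i) y" "\<sigma> (inv_into {0..} (\<lambda>r. \<sigma> r i) y) i = y"
proof -
  have "continuous_on {0..y} (\<lambda>r. \<sigma> r i)"
    using sigma_continuous by (rule continuous_on_subset) auto
  then obtain x where "0 \<le> x" "\<sigma> x i = y"
    using IVT'[of "\<lambda>r. \<sigma> r i" 0 y y] assms le_sigma[of y i] by (auto simp: sigma_zero)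
  then have "y \<in> (\<lambda>r. \<sigma> r i) ` {0..}" by auto
  from f_inv_into_f[OF this] inv_into_into[OF this]
  show "0 \<le> inv_into {0..} (\<lambda>r. \<sigma> r i) y" "\<sigma> (inv_into {0..} (\<lambda>r. \<sigma> r i) y) i = y"
    by auto
qed

text \<open>The preimages of \<open>{a..b}\<close> under all components lie in one interval
  \<open>{\<delta>..b}\<close> away from 0, where \<open>sigma_bilipschitz\<close> is uniform;
  inversion turns \<open>c\<close>, \<open>C\<close> into \<open>1 / C\<close>,
  \<open>1 / c\<close>.\<close>

lemma sigma_inverse_bilipschitz:
  assumes ab: "0 < a" "a \<le> b"
  obtains c C where "0 < c" "c \<le> C"
    "\<And>i r1 r2. r1 \<in> {a..b} \<Longrightarrow> r2 \<in> {a..b} \<Longrightarrow>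
       c * \<bar>r1 - r2\<bar> \<le> \<bar>inv_into {0..} (\<lambda>r. \<sigma> r i) r1 - inv_into {0..} (\<lambda>r. \<sigma> r i) r2\<bar> \<and>
       \<bar>inv_into {0..} (\<lambda>r. \<sigma> r i) r1 - inv_into {0..} (\<lambda>r. \<sigma> r i) r2\<bar> \<le> C * \<bar>r1 - r2\<bar>"
proof -
  let ?g = "\<lambda>i. inv_into {0..} (\<lambda>r. \<sigma> r i)"
  have "continuous_on {0..b} (\<lambda>r. \<beta> r 0)"
    using KL_K[of 0] by (auto simp: class_K_def elim: continuous_on_subset)
  \<comment> \<open>At \<open>\<delta>\<close> the common upper bound \<open>\<beta> r 0\<close>
    takes the value \<open>a\<close>, so \<open>a \<le> \<sigma> r i\<close> forces
    \<open>\<delta> \<le> r\<close> for every \<open>i\<close>.\<close>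
  then obtain \<delta> where \<delta>: "0 \<le> \<delta>" "\<delta> \<le> b" "\<beta> \<delta> 0 = a"
    using IVT'[of "\<lambda>r. \<beta> r 0" 0 a b] ab le_KL_0[of b] by (auto simp: KL_zero)
  then have \<delta>0: "0 < \<delta>"
    using ab by (cases "\<delta> = 0") (auto simp: KL_zero)
  have g_range: "\<delta> \<le> ?g i r" "?g i r \<le> b" if "r \<in> {a..b}" for i r
  proof -
    have g: "0 \<le> ?g i r" "\<sigma> (?g i r) i = r"
      using sigma_inverse[of r i] that ab by auto
    show "?g i r \<le> b"
      using le_sigma[OF g(1), of i] g(2) that by simp
    have "\<beta> \<delta> 0 \<le> \<beta> (?g i r) 0"
      using sigma_bound[OF g(1), of i] g(2) that \<delta> by simp
    moreover have "strict_mono_on {0..} (\<lambda>r. \<beta> r 0)"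
      using KL_K[of 0] by (simp add: class_K_def)
    ultimately show "\<delta> \<le> ?g i r"
      using strict_mono_onD[of "{0..}" "\<lambda>r. \<beta> r 0" "?g i r" \<delta>] g(1) \<delta>(1) by force
  qed
  obtain c C where cC: "0 < c" "c \<le> C"
    and lip: "\<And>i r1 r2. \<delta> \<le> r1 \<Longrightarrow> r1 \<le> r2 \<Longrightarrow> r2 \<le> b \<Longrightarrow>
       c * (r2 - r1) \<le> \<sigma> r2 i - \<sigma> r1 i \<and> \<sigma> r2 i - \<sigma> r1 i \<le> C * (r2 - r1)"
    using sigma_bilipschitz[OF \<delta>0 \<delta>(2)] by blast
  have lip_abs: "c * \<bar>x - y\<bar> \<le> \<bar>\<sigma> x i - \<sigma> y i\<bar> \<and> \<bar>\<sigma> x i - \<sigma> y i\<bar> \<le> C * \<bar>x - y\<bar>"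
    if "x \<in> {\<delta>..b}" "y \<in> {\<delta>..b}" for x y i
  proof (cases "x \<le> y")
    case True
    then have "0 \<le> c * (y - x)" using cC by simp
    then show ?thesis using lip[of x y i] that True by auto
  next
    case False
    then have "0 \<le> c * (x - y)" using cC by simp
    then show ?thesis using lip[of y x i] that False by auto
  qed
  show thesis
  proof (rule that[of "1 / C" "1 / c"])
    show "0 < 1 / C" "1 / C \<le> 1 / c" using cC by (auto intro: divide_left_mono)
    fix i r1 r2 assume r: "r1 \<in> {a..b}" "r2 \<in> {a..b}"
    have "\<sigma> (?g i r1) i = r1" "\<sigma> (?g i r2) i = r2"
      using sigma_inverse(2)[of r1 i] sigma_inverse(2)[of r2 i] r ab by auto
    then have "c * \<bar>?g i r1 - ?g i r2\<bar> \<le> \<bar>r1 - r2\<bar>" "\<bar>r1 - r2\<bar> \<le> C * \<bar>?g i r1 - ?g i r2\<bar>"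
      using lip_abs[of "?g i r1" "?g i r2" i] g_range r by auto
    then show "1 / C * \<bar>r1 - r2\<bar> \<le> \<bar>?g i r1 - ?g i r2\<bar> \<and>
        \<bar>?g i r1 - ?g i r2\<bar> \<le> 1 / c * \<bar>r1 - r2\<bar>"
      using cC by (simp add: field_simps)
  qed
qed

section \<open>The path-of-decay properties and the theorem\<close>

lemma path_of_decay_sigma: "path_of_decay \<Gamma> (sigma_lower \<Gamma>)"
  unfolding path_of_decay_def Let_def
proof (intro conjI allI impI)
  show "\<exists>\<sigma>min \<sigma>max. class_Kinf \<sigma>min \<and> class_Kinf \<sigma>max \<and>
      (\<forall>i. \<forall>r\<ge>0. \<sigma>min r \<le> \<sigma> r i \<and> \<sigma> r i \<le> \<sigma>max r)"
  \<comment> \<open>The witnesses come from \<open>r \<le> \<sigma> r i \<le> \<beta> r 0\<close>: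
    the identity below and \<open>\<beta> r 0\<close> above.\<close>
  proof (intro exI conjI allI impI)
    show "class_Kinf (\<lambda>r. r)"
      by (rule class_KinfI) (auto simp: class_K_def intro: strict_mono_onI)
  qed (use KL_Kinf le_sigma sigma_bound in auto)
next
  fix a b :: real assume "0 < a \<and> a \<le> b"
  then have ab: "0 < a" "a \<le> b" by auto
  show "\<exists>c C. 0 < c \<and> c \<le> C \<and>
     (\<forall>i. \<forall>r1\<in>{a..b}. \<forall>r2\<in>{a..b}.
       c * \<bar>r1 - r2\<bar> \<le> \<bar>inv_into {0..} (\<lambda>r. \<sigma> r i) r1 - inv_into {0..} (\<lambda>r. \<sigma> r i) r2\<bar> \<and>
       \<bar>inv_into {0..} (\<lambda>r. \<sigma> r i) r1 - inv_into {0..} (\<lambda>r. \<sigma> r i) r2\<bar> \<le> C * \<bar>r1 - r2\<bar>)"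
    by (rule sigma_inverse_bilipschitz[OF ab]) blast
qed (auto intro: gain_sigma_le sigma_Kinf)

end

theorem theorem5p12:
  fixes I :: "nat \<Rightarrow> nat set" and \<gamma> :: "nat \<Rightarrow> nat \<Rightarrow> real \<Rightarrow> real"
  assumes gains: "max_type_gains I \<gamma>"
    and well_defined: "gain_well_defined \<gamma>"
    and continuous: "continuous_on linf_pos (gain_op \<gamma>)"
    and ugas: "UGAS (gain_op \<gamma>)"
    and bilipschitz: "\<And>a b. 0 < a \<Longrightarrow> a \<le> b \<Longrightarrow>
      \<exists>l L. 0 < l \<and> l < L \<and>
        (\<forall>i. \<forall>j\<in>I i. \<forall>r1\<in>{a..b}. \<forall>r2\<in>{a..b}.
           l * \<bar>r1 - r2\<bar> \<le> \<bar>\<gamma> i j r1 - \<gamma> i j r2\<bar> \<and>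
           \<bar>\<gamma> i j r1 - \<gamma> i j r2\<bar> \<le> L * \<bar>r1 - r2\<bar>)"
  shows "(\<forall>r\<ge>0. bounded (range (\<lambda>k. (augmented (gain_op \<gamma>) ^^ k) (const_bcontfun r)))) \<and>
    (\<exists>\<phi>. admissible (gain_op \<gamma>) \<phi>) \<and>
    (\<forall>\<phi>. admissible (gain_op \<gamma>) \<phi> \<longrightarrow>
      (\<forall>r\<ge>0. \<forall>i. apply_bcontfun (sigma_lower (gain_op \<gamma>) r) i = sigma_upper (gain_op \<gamma>) \<phi> r i)) \<and>
    path_of_decay (gain_op \<gamma>) (sigma_lower (gain_op \<gamma>))"
proof -
  obtain \<beta> where "class_KL \<beta>"
    "\<And>s k. s \<in> linf_pos \<Longrightarrow> norm ((gain_op \<gamma> ^^ k) s) \<le> \<beta> (norm s) (real k)"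
    using ugas unfolding UGAS_def by blast
  then interpret bilipschitz_gain I \<gamma> \<beta>
    using gains well_defined bilipschitz by unfold_locales
  show ?thesis
    using bounded_augmented_orbit admissible_KL sigma_lower_eq_upper path_of_decay_sigma by blast
qed

end
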